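(* Let $V,\Lambda,\mu_s,\mu_o,w_s,K>0$ with $V\ge\overline{C}_s:=\frac{w_s}{\mu_s}+2\sqrt{\frac{w_s}{\Lambda\mu_s}}$, and suppose $(w_s,K)\in\mathcal H$, i.e. the optimal service deployment is to operate both services. Let $p_o^*,W_o^*,W_s^*$ be the price and lead time of the on-demand service and the lead time of the standard service in the optimal hybrid policy (with $\lambda_s^*,\lambda_o^*>0$), and $p_o^O,W_o^O$ the price and lead time of the on-demand service in the optimal policy of System O (on-demand service only). Compared to System O, the hybrid model with two services will: (a) reduce the price while enlarging the lead time of the on-demand service ($p_o^*\le p_o^O$ and $W_o^*\ge W_o^O$) if the on-demand service has the longer lead time ($(w_s,K)\in\mathcal H_1$, i.e. $W_o^*>W_s^*$) and $(w_s,K)\in\mathcal T_1$; (b) increase the price but shorten the lead time of the on-demand service ($p_o^*\ge p_o^O$ and $W_o^*\le W_o^O$) if the on-demand service has the shorter lead time ($(w_s,K)\in\mathcal H_2$, i.e. $W_o^*<W_s^*$) and $(w_s,K)\in\mathcal T_2$.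
   Context: Customers arrive at rate $\Lambda$ and have types $\theta$ uniform on $[0,1]$. Service $i\in\{s,o\}$ (standard, on-demand) with price $p_i$ and lead time $W_i$ gives utility $U_i=V-p_i-\theta W_i$; each customer joins the service with the highest nonnegative utility or balks (each customer joins at most one service; if the two services are identical in price and lead time, any split is allowed). Hybrid model: the service provider chooses $p_s,p_o$, the number $k_s\ge0$ of employees (service rate $\mu_s$, hourly wage $w_s$), and the per-service wage $w_o$ of contractors (service rate $\mu_o$, pool size $K$, reservation rates $r$ uniform on $[0,1]$), to maximize $p_s\lambda_s-w_sk_s+p_o\lambda_o-\lambda_ow_o$ subject to $\lambda_s=\Lambda\Pr(U_s\ge0,U_s\ge U_o)$, $\lambda_o=\Lambda\Pr(U_o\ge0,U_o\ge U_s)$, $W_i=1/(k_i\mu_i-\lambda_i)$ with $k_i\mu_i>\lambda_i$, and $k_o=K\Pr(\lambda_ow_o/k_o\ge r)$ with the uniform distribution function taken as $x\mapsto x$, i.e. $k_o^2=K\lambda_ow_o$. A service may be not offered ($\lambda_i=k_i=0$, no cost). Regime $\mathcal H$ is the set of $(w_s,K)$ for which this problem has an optimal solution with both $\lambda_s^*>0$ and $\lambda_o^*>0$; $\mathcal H_1$ (resp. $\mathcal H_2$) is the subset where on-demand service has the longer (resp. shorter) lead time in the optimal solution. System O: only the on-demand service is offered; the provider maximizes $p_o\lambda_o-\lambda_ow_o$ with $\lambda_o=\Lambda\Pr(U_o\ge0)$, $W_o=1/(k_o\mu_o-\lambda_o)$, $k_o\mu_o>\lambda_o$, $k_o^2=K\lambda_ow_o$.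 Notation: $a=\frac{w_s\Lambda}{\mu_s}$, $\sigma=\sqrt{V\Lambda+1}$, $\bar K=\frac{2\Lambda^2\sigma}{\mu_o^2(\sigma-1)^3}$, $\bar L_o=\max\{L>0:\frac{L^3}{1+L}\le\frac{2\Lambda^2}{K\mu_o^2}\}$. Definition of $\mathcal T_1$: with $G(\lambda)=\sqrt{1+a+\frac{2\sqrt a\,\lambda}{\sqrt{\Lambda^2-\lambda^2}}}$, $\mathcal T_1$ is the set of $(w_s,K)$ such that the optimal hybrid on-demand arrival rate $\lambda_o^*$ satisfies $$\frac{(G(\lambda_o^* )-1)^3}{G(\lambda_o^* )}=\frac{2\Lambda\lambda_o^*}{K\mu_o^2}$$ and, if $K\le\bar K$, $$G(\lambda_o^* )+\sqrt{\frac{w_s\Lambda(\Lambda-\lambda_o^* )}{\mu_s(\Lambda+\lambda_o^* )}}-\sigma\ge0,\qquad \frac{2\Lambda}{K\mu_o^2}-\frac{(\lambda_o^* )^2c^3}{\lambda_o^*c+1}\ge0\quad\text{with }c=\frac{\bar K(\sigma-1)}{K\Lambda},$$ while, if $K>\bar K$, $$G(\lambda_o^* )-1+\sqrt{\frac{w_s\Lambda(\Lambda-\lambda_o^* )}{\mu_s(\Lambda+\lambda_o^* )}}-\bar L_o\ge0,\qquad \frac{2\Lambda}{K\mu_o^2}-\frac{(\lambda_o^* )^2c^3}{\lambda_o^*c+1}\ge0\quad\text{with }c=\frac{\bar L_o}{\Lambda}.$$ Definition of $\mathcal T_2$: with $H(\lambda)=\frac{-\Lambda+\lambda+\sqrt{(\Lambda-\lambda)^2+(2\Lambda-\lambda)\lambda(a+2\sqrt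 a)}}{2\Lambda-\lambda}$, $\mathcal T_2$ is the set of $(w_s,K)$ such that the optimal hybrid on-demand arrival rate $\lambda_o^*$ satisfies $$\frac{H(\lambda_o^* )^3}{H(\lambda_o^* )+1}=\frac{2\Lambda(\lambda_o^* )^2}{K\mu_o^2(2\Lambda-\lambda_o^* )}\qquad\text{and}\qquad \frac{2\Lambda}{K\mu_o^2(2\Lambda-\lambda_o^* )}-\frac{\lambda_o^*c^3}{\lambda_o^*c+1}\le0,$$ where $c=\frac{\sigma-1}{\Lambda}$ if $K\le\bar K$ and $c=\frac{\bar L_o}{\Lambda}$ if $K>\bar K$. *)

theory Defs
  imports "HOL-Analysis.Analysis"
begin

subsection \<open>Customer choice\<close>

definition type_prob :: "(real \<Rightarrow> bool) \<Rightarrow> real" where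
  "type_prob P = measure (uniform_measure lborel {0..1}) {\<theta>. P \<theta>}"

definition utility :: "real \<Rightarrow> real \<Rightarrow> real \<Rightarrow> real \<Rightarrow> real" where
  "utility V p W \<theta> = V - p - \<theta> * W"

subsection \<open>System O: on-demand service only\<close>

text \<open>A policy lists the decisions of the provider together with the arrival rate, number of
  servers and lead time that they induce; the constraints couple these quantities, and the
  provider optimizes over all admissible combinations. Prices are unrestricted real numbers.\<close>

record ondemand =
  price_o :: real
  wage_o :: real
  rate_o :: real
  staff_o :: real
  lead_o :: real

text \<open>The last conjunct is the participation condition
  \<open>k\<^sub>o = K F(\<lambda>\<^sub>o w\<^sub>o / k\<^sub>o)\<close> with the distribution function \<open>F x = x\<close>,
  which is not truncated at 1. Together with the first conjunct it forces
  \<open>k\<^sub>o\<close>, \<open>\<lambda>\<^sub>o\<close> and \<open>w\<^sub>o\<close> to be positive whenever \<open>\<lambda>\<^sub>o \<ge> 0\<close> and \<open>\<mu>\<^sub>o, K > 0\<close>.\<close>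

definition ondemand_operation :: "real \<Rightarrow> real \<Rightarrow> 'a ondemand_scheme \<Rightarrow> bool" where
  "ondemand_operation \<mu>o K q \<longleftrightarrow>
     staff_o q * \<mu>o > rate_o q \<and>
     lead_o q = 1 / (staff_o q * \<mu>o - rate_o q) \<and>
     (staff_o q)\<^sup>2 = K * rate_o q * wage_o q"

definition feasible_O :: "real \<Rightarrow> real \<Rightarrow> real \<Rightarrow> real \<Rightarrow> ondemand \<Rightarrow> bool" where
  "feasible_O V \<Lambda> \<mu>o K q \<longleftrightarrow>
     rate_o q = \<Lambda> * type_prob (\<lambda>\<theta>. utility V (price_o q) (lead_o q) \<theta> \<ge> 0) \<and>
     ondemand_operation \<mu>o K q"

definition profit_O :: "ondemand \<Rightarrow> real" where
  "profit_O q = price_o q * rate_o q - rate_o q * wage_o q"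

definition optimal_O :: "real \<Rightarrow> real \<Rightarrow> real \<Rightarrow> real \<Rightarrow> ondemand \<Rightarrow> bool" where
  "optimal_O V \<Lambda> \<mu>o K q \<longleftrightarrow> is_arg_max profit_O (feasible_O V \<Lambda> \<mu>o K) q"

subsection \<open>Hybrid model\<close>

record hybrid = ondemand +
  offers_s :: bool
  offers_o :: bool
  price_s :: real
  rate_s :: real
  staff_s :: real
  lead_s :: real

text \<open>A service that is not offered attracts nobody and does not compete with the other one.
  Ties between two offered services have probability zero unless price and lead time both agree,
  in which case the joining customers may be split between them arbitrarily.\<close>

definition hybrid_demand :: "real \<Rightarrow> real \<Rightarrow> hybrid \<Rightarrow> bool" where
  "hybrid_demand V \<Lambda> x \<longleftrightarrow>
     (let Us = utility V (price_s x) (lead_s x);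
          Uo = utility V (price_o x) (lead_o x)
      in if offers_s x \<and> offers_o x \<and> price_s x = price_o x \<and> lead_s x = lead_o x
         then rate_s x \<ge> 0 \<and> rate_o x \<ge> 0 \<and>
              rate_s x + rate_o x = \<Lambda> * type_prob (\<lambda>\<theta>. Us \<theta> \<ge> 0)
         else rate_s x = \<Lambda> * type_prob (\<lambda>\<theta>. offers_s x \<and> Us \<theta> \<ge> 0 \<and> (offers_o x \<longrightarrow> Us \<theta> \<ge> Uo \<theta>)) \<and>
              rate_o x = \<Lambda> * type_prob (\<lambda>\<theta>. offers_o x \<and> Uo \<theta> \<ge> 0 \<and> (offers_s x \<longrightarrow> Uo \<theta> \<ge> Us \<theta>)))"

definition standard_operation :: "real \<Rightarrow> hybrid \<Rightarrow> bool" where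
  "standard_operation \<mu>s x \<longleftrightarrow>
     staff_s x \<ge> 0 \<and>
     staff_s x * \<mu>s > rate_s x \<and>
     lead_s x = 1 / (staff_s x * \<mu>s - rate_s x)"

definition feasible_hybrid :: "real \<Rightarrow> real \<Rightarrow> real \<Rightarrow> real \<Rightarrow> real \<Rightarrow> hybrid \<Rightarrow> bool" where
  "feasible_hybrid V \<Lambda> \<mu>s \<mu>o K x \<longleftrightarrow>
     hybrid_demand V \<Lambda> x \<and>
     (if offers_s x then standard_operation \<mu>s x else rate_s x = 0 \<and> staff_s x = 0) \<and>
     (if offers_o x then ondemand_operation \<mu>o K x else rate_o x = 0 \<and> staff_o x = 0)"

definition profit_hybrid :: "real \<Rightarrow> hybrid \<Rightarrow> real" where
  "profit_hybrid ws x =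
     price_s x * rate_s x - ws * staff_s x + price_o x * rate_o x - rate_o x * wage_o x"

definition optimal_hybrid ::
    "real \<Rightarrow> real \<Rightarrow> real \<Rightarrow> real \<Rightarrow> real \<Rightarrow> real \<Rightarrow> hybrid \<Rightarrow> bool" where
  "optimal_hybrid V \<Lambda> \<mu>s \<mu>o ws K x \<longleftrightarrow>
     is_arg_max (profit_hybrid ws) (feasible_hybrid V \<Lambda> \<mu>s \<mu>o K) x"

subsection \<open>Parameter thresholds and the conditions defining the two regions\<close>

definition C_bar_s :: "real \<Rightarrow> real \<Rightarrow> real \<Rightarrow> real" where
  "C_bar_s \<Lambda> \<mu>s ws = ws / \<mu>s + 2 * sqrt (ws / (\<Lambda> * \<mu>s))"

definition sigma :: "real \<Rightarrow> real \<Rightarrow> real" where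
  "sigma V \<Lambda> = sqrt (V * \<Lambda> + 1)"

definition K_bar :: "real \<Rightarrow> real \<Rightarrow> real \<Rightarrow> real" where
  "K_bar V \<Lambda> \<mu>o = 2 * \<Lambda>\<^sup>2 * sigma V \<Lambda> / (\<mu>o\<^sup>2 * (sigma V \<Lambda> - 1) ^ 3)"

definition L_bar_o :: "real \<Rightarrow> real \<Rightarrow> real \<Rightarrow> real" where
  "L_bar_o \<Lambda> \<mu>o K = (GREATEST L. L > 0 \<and> L ^ 3 / (1 + L) \<le> 2 * \<Lambda>\<^sup>2 / (K * \<mu>o\<^sup>2))"

definition G_fun :: "real \<Rightarrow> real \<Rightarrow> real \<Rightarrow> real \<Rightarrow> real" where
  "G_fun \<Lambda> \<mu>s ws l =
     (let a = ws * \<Lambda> / \<mu>s in sqrt (1 + a + 2 * sqrt a * l / sqrt (\<Lambda>\<^sup>2 - l\<^sup>2)))"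

definition H_fun :: "real \<Rightarrow> real \<Rightarrow> real \<Rightarrow> real \<Rightarrow> real" where
  "H_fun \<Lambda> \<mu>s ws l =
     (let a = ws * \<Lambda> / \<mu>s
      in (- \<Lambda> + l + sqrt ((\<Lambda> - l)\<^sup>2 + (2 * \<Lambda> - l) * l * (a + 2 * sqrt a))) / (2 * \<Lambda> - l))"

text \<open>The argument \<open>l\<close> of the two conditions below stands for the on-demand arrival rate of the
  optimal hybrid policy under consideration.\<close>

definition T1_condition ::
    "real \<Rightarrow> real \<Rightarrow> real \<Rightarrow> real \<Rightarrow> real \<Rightarrow> real \<Rightarrow> real \<Rightarrow> bool" where
  "T1_condition V \<Lambda> \<mu>s \<mu>o ws K l \<longleftrightarrow>
     (let G = G_fun \<Lambda> \<mu>s ws l;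
          R = sqrt (ws * \<Lambda> * (\<Lambda> - l) / (\<mu>s * (\<Lambda> + l)));
          D = (\<lambda>c. 2 * \<Lambda> / (K * \<mu>o\<^sup>2) - l\<^sup>2 * c ^ 3 / (l * c + 1))
      in (G - 1) ^ 3 / G = 2 * \<Lambda> * l / (K * \<mu>o\<^sup>2) \<and>
         (K \<le> K_bar V \<Lambda> \<mu>o \<longrightarrow>
            G + R - sigma V \<Lambda> \<ge> 0 \<and>
            D (K_bar V \<Lambda> \<mu>o * (sigma V \<Lambda> - 1) / (K * \<Lambda>)) \<ge> 0) \<and>
         (K > K_bar V \<Lambda> \<mu>o \<longrightarrow>
            G - 1 + R - L_bar_o \<Lambda> \<mu>o K \<ge> 0 \<and>
            D (L_bar_o \<Lambda> \<mu>o K / \<Lambda>) \<ge> 0))"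

definition T2_condition ::
    "real \<Rightarrow> real \<Rightarrow> real \<Rightarrow> real \<Rightarrow> real \<Rightarrow> real \<Rightarrow> real \<Rightarrow> bool" where
  "T2_condition V \<Lambda> \<mu>s \<mu>o ws K l \<longleftrightarrow>
     (let H = H_fun \<Lambda> \<mu>s ws l;
          c = (if K \<le> K_bar V \<Lambda> \<mu>o then (sigma V \<Lambda> - 1) / \<Lambda> else L_bar_o \<Lambda> \<mu>o K / \<Lambda>)
      in H ^ 3 / (H + 1) = 2 * \<Lambda> * l\<^sup>2 / (K * \<mu>o\<^sup>2 * (2 * \<Lambda> - l)) \<and>
         2 * \<Lambda> / (K * \<mu>o\<^sup>2 * (2 * \<Lambda> - l)) - l * c ^ 3 / (l * c + 1) \<le> 0)"

end

theory Submission
  imports Defs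
begin

text \<open>Once prices are eliminated, the profit is an explicit function of arrival rates and lead times.
  The relation between the on-demand rate and lead time in either model comes from the first-order
  condition in that lead time. In the hybrid optimum all customers are served: along a curve on
  which \<open>\<lambda>\<^sub>s W\<^sub>s\<close> is constant the profit is affine in \<open>\<lambda>\<^sub>s\<close>, so at an optimum with unserved
  customers it would be constant, and optimality at two points of the curve is contradictory.
  Since \<open>L \<mapsto> L\<^sup>3 / (1 + L)\<close> is increasing, the inequalities in the definitions of the two regions
  then compare the two lead times, and the prices follow.\<close>

subsection \<open>Customer choice\<close>

text \<open>The uniform measure of the event is the length of its trace on \<open>{0..1}\<close>;
  the outer \<open>max 0\<close> covers an empty trace. As \<open>P\<close> is unrestricted outside
  \<open>{0..1}\<close>, measurability is a separate hypothesis.\<close>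

lemma type_prob_interval:
  assumes sets: "{\<theta>. P \<theta>} \<in> sets borel"
    and P: "\<And>\<theta>. 0 \<le> \<theta> \<Longrightarrow> \<theta> \<le> 1 \<Longrightarrow> P \<theta> \<longleftrightarrow> a \<le> \<theta> \<and> \<theta> \<le> b"
  shows "type_prob P = max 0 (min 1 b - max 0 a)"
proof -
  have "{0..1} \<inter> {\<theta>. P \<theta>} = {max 0 a..min 1 b}"
    using P by auto
  then have "type_prob P = measure lborel {max 0 a..min 1 b}"
    using sets unfolding type_prob_def by (subst measure_uniform_measure) auto
  then show ?thesis
    by (auto simp: max_def min_def)
qed

lemma type_prob_single:
  assumes "W > 0"
  shows "type_prob (\<lambda>\<theta>. utility V p W \<theta> \<ge> 0) = max 0 (min 1 ((V - p) / W))"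
proof -
  have "{\<theta>. utility V p W \<theta> \<ge> 0} \<in> sets borel"
    unfolding utility_def by measurable
  moreover have "utility V p W \<theta> \<ge> 0 \<longleftrightarrow> 0 \<le> \<theta> \<and> \<theta> \<le> (V - p) / W" if "0 \<le> \<theta>" for \<theta>
    using assms that by (auto simp: utility_def field_simps)
  ultimately show ?thesis
    using type_prob_interval[of "\<lambda>\<theta>. utility V p W \<theta> \<ge> 0" 0 "(V - p) / W"] by simp
qed

text \<open>Delay-sensitive types prefer the faster service: it wins above the indifferent type
  \<open>(p1 - p2) / (W2 - W1)\<close>, the slower one below it, while participation bounds types
  from above in either case.\<close>

lemma type_prob_fast:
  assumes "0 < W1" "W1 < W2"
  shows "type_prob (\<lambda>\<theta>. utility V p1 W1 \<theta> \<ge> 0 \<and> utility V p1 W1 \<theta> \<ge> utility V p2 W2 \<theta>)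
    = max 0 (min 1 ((V - p1) / W1) - max 0 ((p1 - p2) / (W2 - W1)))"
proof (rule type_prob_interval)
  show "{\<theta>. utility V p1 W1 \<theta> \<ge> 0 \<and> utility V p1 W1 \<theta> \<ge> utility V p2 W2 \<theta>} \<in> sets borel"
    unfolding utility_def by measurable
next
  fix \<theta> :: real
  have "utility V p1 W1 \<theta> \<ge> 0 \<longleftrightarrow> \<theta> \<le> (V - p1) / W1"
    using assms by (auto simp: utility_def field_simps)
  moreover have "utility V p1 W1 \<theta> \<ge> utility V p2 W2 \<theta> \<longleftrightarrow> (p1 - p2) / (W2 - W1) \<le> \<theta>"
    using assms by (auto simp: utility_def field_simps)
  ultimately show "utility V p1 W1 \<theta> \<ge> 0 \<and> utility V p1 W1 \<theta> \<ge> utility V p2 W2 \<theta> \<longleftrightarrow>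
      (p1 - p2) / (W2 - W1) \<le> \<theta> \<and> \<theta> \<le> (V - p1) / W1"
    by blast
qed

lemma type_prob_slow:
  assumes "0 < W1" "W1 < W2"
  shows "type_prob (\<lambda>\<theta>. utility V p2 W2 \<theta> \<ge> 0 \<and> utility V p2 W2 \<theta> \<ge> utility V p1 W1 \<theta>)
    = max 0 (min 1 (min ((V - p2) / W2) ((p1 - p2) / (W2 - W1))))"
proof -
  have sets: "{\<theta>. utility V p2 W2 \<theta> \<ge> 0 \<and> utility V p2 W2 \<theta> \<ge> utility V p1 W1 \<theta>} \<in> sets borel"
    unfolding utility_def by measurable
  have "utility V p2 W2 \<theta> \<ge> 0 \<and> utility V p2 W2 \<theta> \<ge> utility V p1 W1 \<theta> \<longleftrightarrow>
      0 \<le> \<theta> \<and> \<theta> \<le> min ((V - p2) / W2) ((p1 - p2) / (W2 - W1))" if "0 \<le> \<theta>" for \<theta>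
  proof -
    have "utility V p2 W2 \<theta> \<ge> 0 \<longleftrightarrow> \<theta> \<le> (V - p2) / W2"
      using assms by (auto simp: utility_def field_simps)
    moreover have "utility V p2 W2 \<theta> \<ge> utility V p1 W1 \<theta> \<longleftrightarrow> \<theta> \<le> (p1 - p2) / (W2 - W1)"
      using assms by (auto simp: utility_def field_simps)
    ultimately show ?thesis
      using that by auto
  qed
  from type_prob_interval[OF sets this] show ?thesis
    by simp
qed

text \<open>An indifferent customer of type \<open>(p1 - p2) / (W2 - W1)\<close> gets positive utility from both
  services, so the slow service attracts exactly the types below it.\<close>

lemma choice_shares:
  fixes V p1 W1 p2 W2 n1 n2 :: real
  defines "n1 \<equiv> type_prob (\<lambda>\<theta>. utility V p1 W1 \<theta> \<ge> 0 \<and> utility V p1 W1 \<theta> \<ge> utility V p2 W2 \<theta>)"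
    and "n2 \<equiv> type_prob (\<lambda>\<theta>. utility V p2 W2 \<theta> \<ge> 0 \<and> utility V p2 W2 \<theta> \<ge> utility V p1 W1 \<theta>)"
  assumes W: "0 < W1" "W1 < W2" and pos: "n1 > 0" "n2 > 0"
  shows "p2 = p1 - n2 * (W2 - W1)" "n1 + n2 = min 1 ((V - p1) / W1)"
proof -
  define t where "t = (p1 - p2) / (W2 - W1)"
  let ?v = "(V - p1) / W1"
  have n1: "n1 = max 0 (min 1 ?v - max 0 t)"
    unfolding n1_def t_def using W by (rule type_prob_fast)
  have n2: "n2 = max 0 (min 1 (min ((V - p2) / W2) t))"
    unfolding n2_def t_def using W by (rule type_prob_slow)
  \<comment> \<open>Positive shares rule out the clipped cases of both formulas.\<close>
  have t: "0 < t" "t < ?v" "t < 1"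
    using n1 n2 pos by auto
  have diff: "p1 - p2 = t * (W2 - W1)"
    using W by (simp add: t_def)
  moreover have "t * W1 < V - p1"
    using t(2) W by (simp add: pos_less_divide_eq)
  ultimately have "t * W2 < V - p2"
    by (simp add: algebra_simps)
  then have "t < (V - p2) / W2"
    using W by (simp add: pos_less_divide_eq)
  then have "n2 = t"
    using n2 t by (simp add: min_def)
  moreover have "n1 = min 1 ?v - t"
    using n1 t by (auto simp: min_def)
  ultimately show "p2 = p1 - n2 * (W2 - W1)" "n1 + n2 = min 1 ?v"
    using diff by auto
qed

text \<open>Converse of \<open>choice_shares\<close>: the prices make type \<open>n2\<close>
  indifferent between the services and leave type \<open>n1 + n2\<close> with zero utility from
  service 1.\<close>

lemma choice_shares_attained:
  fixes V W1 W2 n1 n2 :: real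
  defines "p1 \<equiv> V - (n1 + n2) * W1" and "p2 \<equiv> V - (n1 * W1 + n2 * W2)"
  assumes W: "0 < W1" "W1 < W2" and n: "n1 > 0" "n2 > 0" "n1 + n2 \<le> 1"
  shows "type_prob (\<lambda>\<theta>. utility V p1 W1 \<theta> \<ge> 0 \<and> utility V p1 W1 \<theta> \<ge> utility V p2 W2 \<theta>) = n1"
    and "type_prob (\<lambda>\<theta>. utility V p2 W2 \<theta> \<ge> 0 \<and> utility V p2 W2 \<theta> \<ge> utility V p1 W1 \<theta>) = n2"
proof -
  have t: "(p1 - p2) / (W2 - W1) = n2"
    using W by (simp add: p1_def p2_def divide_simps) (simp add: algebra_simps)
  have v: "(V - p1) / W1 = n1 + n2"
    using W by (simp add: p1_def)
  have "(V - p2) / W2 \<ge> n2"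
    using W n by (simp add: p2_def pos_le_divide_eq)
  then show "type_prob (\<lambda>\<theta>. utility V p2 W2 \<theta> \<ge> 0 \<and> utility V p2 W2 \<theta> \<ge> utility V p1 W1 \<theta>) = n2"
    using n type_prob_slow[OF W, of V p2 p1] t by simp
  show "type_prob (\<lambda>\<theta>. utility V p1 W1 \<theta> \<ge> 0 \<and> utility V p1 W1 \<theta> \<ge> utility V p2 W2 \<theta>) = n1"
    using n type_prob_fast[OF W, of V p1 p2] t v by simp
qed

subsection \<open>First-order conditions\<close>

lemma local_max_deriv_zero:
  fixes f :: "real \<Rightarrow> real"
  assumes "(f has_real_derivative D) (at x)" "\<forall>\<^sub>F y in nhds x. f y \<le> f x"
  shows "D = 0"
proof -
  obtain d where "d > 0" "\<And>y. dist y x < d \<Longrightarrow> f y \<le> f x"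
    using assms(2) by (auto simp: eventually_nhds_metric)
  then show ?thesis
    using DERIV_local_max[OF assms(1), of d] by (auto simp: dist_real_def abs_minus_commute)
qed

text \<open>Trade-off for the standard lead time: the revenue loss is linear in it, the staffing
  cost inversely proportional.\<close>

lemma local_max_linear_inverse:
  fixes A B t :: real
  assumes "t > 0" "\<forall>\<^sub>F s in nhds t. - A * s - B / s \<le> - A * t - B / t"
  shows "A * t\<^sup>2 = B"
proof -
  have "((\<lambda>s. - A * s - B / s) has_real_derivative (- A + B / t\<^sup>2)) (at t)"
    using assms(1) by (auto intro!: derivative_eq_intros simp: power2_eq_square)
  from local_max_deriv_zero[OF this assms(2)] show ?thesis
    using assms(1) by (simp add: field_simps)
qed

text \<open>Trade-off for the on-demand lead time. The contractor cost is quadratic in the capacity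
  \<open>l + 1 / v\<close>, which produces the ratio \<open>w ^ 3 / (l * w + 1)\<close> found in the
  definitions of the regions.\<close>

lemma local_max_linear_square:
  fixes A C D l w :: real
  assumes pos: "w > 0" "l > 0" "C > 0" "D > 0"
    and "\<forall>\<^sub>F v in nhds w. - (A / D) * v - (l + 1 / v)\<^sup>2 / C \<le> - (A / D) * w - (l + 1 / w)\<^sup>2 / C"
  shows "A * (w ^ 3 / (l * w + 1)) = 2 * D / C"
proof -
  define B where "B = A / D"
  have "((\<lambda>v. - B * v - (l + 1 / v)\<^sup>2 / C) has_real_derivative
      (- B + 2 * (l + 1 / w) / w\<^sup>2 / C)) (at w)"
    using pos by (auto intro!: derivative_eq_intros simp: power2_eq_square field_simps)
  from local_max_deriv_zero[OF this assms(5)[folded B_def]]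
  have "B * C * w ^ 3 = 2 * (l * w + 1)"
    using pos by (simp add: field_simps power2_eq_square power3_eq_cube)
  moreover have "l * w + 1 > 0"
    using pos by (simp add: add_pos_pos)
  ultimately have foc: "B * (w ^ 3 / (l * w + 1)) = 2 / C"
    using pos by (simp add: nonzero_eq_divide_eq nonzero_divide_eq_eq mult.commute mult.left_commute)
  have "A * (w ^ 3 / (l * w + 1)) = D * (B * (w ^ 3 / (l * w + 1)))"
    using pos by (simp add: B_def)
  then show ?thesis
    unfolding foc by simp
qed

lemma quadratic_deriv:
  fixes a b c w C l :: real
  assumes "C \<noteq> 0"
  shows "((\<lambda>x. c + a * x - b * x\<^sup>2 - (x + w)\<^sup>2 / C) has_real_derivative
    (a - 2 * b * l - 2 * (l + w) / C)) (at l)"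
  using assms by (auto intro!: derivative_eq_intros)

text \<open>After cross-multiplication, strict monotonicity is the sum of
  \<open>x ^ 3 < z ^ 3\<close> and \<open>x * z * x\<^sup>2 < x * z * z\<^sup>2\<close>.\<close>

lemma cube_ratio_le_iff:
  fixes a b :: real
  assumes "a > 0" "b > 0"
  shows "a ^ 3 / (1 + a) \<le> b ^ 3 / (1 + b) \<longleftrightarrow> a \<le> b"
proof -
  have mono: "x ^ 3 / (1 + x) < z ^ 3 / (1 + z)" if "0 < x" "x < z" for x z :: real
  proof -
    have "x ^ 3 < z ^ 3" "x\<^sup>2 < z\<^sup>2"
      using that by (auto intro!: power_strict_mono)
    moreover have "x * z * x\<^sup>2 < x * z * z\<^sup>2"
      using that calculation(2) by (intro mult_strict_left_mono) auto
    ultimately have "x ^ 3 * (1 + z) < z ^ 3 * (1 + x)"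
      by (simp add: algebra_simps power2_eq_square power3_eq_cube)
    then show ?thesis
      using that by (simp add: divide_simps mult.commute)
  qed
  show ?thesis
    using mono[of a b] mono[of b a] assms by (cases a b rule: linorder_cases) auto
qed

lemma cube_ratio_inj:
  fixes a b :: real
  assumes "a > 0" "b > 0" "a ^ 3 / (1 + a) = b ^ 3 / (1 + b)"
  shows "a = b"
  using cube_ratio_le_iff[of a b] cube_ratio_le_iff[of b a] assms by simp

text \<open>Replacing \<open>z\<close> by \<open>l * z\<close> reduces this to
  \<open>cube_ratio_le_iff\<close>, up to the factor \<open>l ^ 3\<close>. It turns the inequalities
  of the two regions into comparisons of lead times.\<close>

lemma scaled_cube_ratio_le_iff:
  fixes l c w :: real
  assumes "l > 0" "c > 0" "w > 0"
  shows "c ^ 3 / (l * c + 1) \<le> w ^ 3 / (l * w + 1) \<longleftrightarrow> c \<le> w"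
proof -
  have "(l * z) ^ 3 / (1 + l * z) = l ^ 3 * (z ^ 3 / (l * z + 1))" for z
    by (simp add: power_mult_distrib add.commute)
  then have "l ^ 3 * (c ^ 3 / (l * c + 1)) \<le> l ^ 3 * (w ^ 3 / (l * w + 1)) \<longleftrightarrow> l * c \<le> l * w"
    using cube_ratio_le_iff[of "l * c" "l * w"] assms by simp
  then show ?thesis
    using assms by (simp only: mult_le_cancel_left_pos zero_less_power)
qed

section \<open>Operating costs in terms of arrival rate and lead time\<close>

locale market =
  fixes V \<Lambda> \<mu>s \<mu>o ws K :: real
  assumes V: "V > 0" and \<Lambda>: "\<Lambda> > 0" and \<mu>s: "\<mu>s > 0" and \<mu>o: "\<mu>o > 0" and ws: "ws > 0"
    and K: "K > 0"
begin

text \<open>Employee wages once staff is eliminated: solving the lead time formula for the capacity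
  gives \<open>l + 1 / W\<close>.\<close>

definition cost_s :: "real \<Rightarrow> real \<Rightarrow> real" where
  "cost_s l W = ws * (l + 1 / W) / \<mu>s"

text \<open>By the participation condition the contractors' wage bill is the squared staff divided
  by \<open>K\<close>.\<close>

definition cost_o :: "real \<Rightarrow> real \<Rightarrow> real" where
  "cost_o l W = (l + 1 / W)\<^sup>2 / (K * \<mu>o\<^sup>2)"

lemma ondemand_operation_cost:
  assumes "ondemand_operation \<mu>o K q"
  shows "rate_o q * wage_o q = cost_o (rate_o q) (lead_o q)" "lead_o q > 0"
proof -
  have s: "staff_o q * \<mu>o > rate_o q" "lead_o q = 1 / (staff_o q * \<mu>o - rate_o q)"
    "(staff_o q)\<^sup>2 = K * rate_o q * wage_o q"
    using assms by (auto simp: ondemand_operation_def)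
  then have "rate_o q + 1 / lead_o q = staff_o q * \<mu>o"
    by simp
  then have "cost_o (rate_o q) (lead_o q) = (staff_o q)\<^sup>2 / K"
    using \<mu>o by (simp add: cost_o_def power_mult_distrib)
  then show "rate_o q * wage_o q = cost_o (rate_o q) (lead_o q)"
    using s(3) K by simp
  show "lead_o q > 0"
    using s by simp
qed

lemma ondemand_operation_attained:
  assumes "rate_o q > 0" "lead_o q > 0"
    and "staff_o q = (rate_o q + 1 / lead_o q) / \<mu>o"
    and "wage_o q = cost_o (rate_o q) (lead_o q) / rate_o q"
  shows "ondemand_operation \<mu>o K q"
proof -
  have "(staff_o q)\<^sup>2 = K * cost_o (rate_o q) (lead_o q)"
    using K by (simp add: assms(3) cost_o_def power_divide)
  then show ?thesis
    using assms \<mu>o by (simp add: ondemand_operation_def)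
qed

lemma standard_operation_cost:
  assumes "standard_operation \<mu>s x"
  shows "ws * staff_s x = cost_s (rate_s x) (lead_s x)" "lead_s x > 0"
proof -
  have s: "staff_s x * \<mu>s > rate_s x" "lead_s x = 1 / (staff_s x * \<mu>s - rate_s x)"
    using assms by (auto simp: standard_operation_def)
  then have "rate_s x + 1 / lead_s x = staff_s x * \<mu>s"
    by simp
  then show "ws * staff_s x = cost_s (rate_s x) (lead_s x)"
    using \<mu>s by (simp add: cost_s_def)
  show "lead_s x > 0"
    using s by simp
qed

lemma standard_operation_attained:
  assumes "rate_s x > 0" "lead_s x > 0" "staff_s x = (rate_s x + 1 / lead_s x) / \<mu>s"
  shows "standard_operation \<mu>s x"
  using assms \<mu>s by (auto simp: standard_operation_def)

subsection \<open>System O\<close>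

text \<open>Profit at \<open>V - l * W / \<Lambda>\<close>, the highest price at which rate
  \<open>l\<close> joins when the lead time is \<open>W\<close>.\<close>

definition net_O :: "real \<Rightarrow> real \<Rightarrow> real" where
  "net_O l W = V * l - l\<^sup>2 * W / \<Lambda> - cost_o l W"

lemma net_O_attained:
  assumes "0 < l" "l \<le> \<Lambda>" "W > 0"
  shows "\<exists>q. feasible_O V \<Lambda> \<mu>o K q \<and> profit_O q = net_O l W"
proof -
  let ?p = "V - l * W / \<Lambda>"
  let ?q = "\<lparr>price_o = ?p, wage_o = cost_o l W / l, rate_o = l,
    staff_o = (l + 1 / W) / \<mu>o, lead_o = W\<rparr>"
  have "ondemand_operation \<mu>o K ?q"
    by (rule ondemand_operation_attained) (use assms in auto)
  moreover have "type_prob (\<lambda>\<theta>. utility V ?p W \<theta> \<ge> 0) = l / \<Lambda>"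
    using assms \<Lambda> by (subst type_prob_single) auto
  ultimately have "feasible_O V \<Lambda> \<mu>o K ?q"
    using \<Lambda> by (simp add: feasible_O_def)
  moreover have "profit_O ?q = net_O l W"
    using assms \<Lambda> by (simp add: profit_O_def net_O_def field_simps power2_eq_square)
  ultimately show ?thesis
    by blast
qed

text \<open>No admissible price exceeds the one built into \<open>net_O\<close>, and every value of
  \<open>net_O\<close> is attained. Hence an optimal policy charges exactly that price and maximizes
  \<open>net_O\<close>.\<close>

lemma optimal_O_net:
  assumes opt: "optimal_O V \<Lambda> \<mu>o K y"
  defines "l0 \<equiv> rate_o y" and "W0 \<equiv> lead_o y"
  shows "0 < l0" "l0 \<le> \<Lambda>" "0 < W0" "price_o y = V - l0 * W0 / \<Lambda>"
    and "\<And>l W. 0 < l \<Longrightarrow> l \<le> \<Lambda> \<Longrightarrow> 0 < W \<Longrightarrow> net_O l W \<le> net_O l0 W0"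
proof -
  have feas: "feasible_O V \<Lambda> \<mu>o K y"
    and best: "\<And>q. feasible_O V \<Lambda> \<mu>o K q \<Longrightarrow> profit_O q \<le> profit_O y"
    using opt by (auto simp: optimal_O_def is_arg_max_linorder)
  then have oper: "ondemand_operation \<mu>o K y"
    by (simp add: feasible_O_def)
  show W0: "0 < W0"
    using ondemand_operation_cost(2)[OF oper] by (simp add: W0_def)
  have l0: "l0 = \<Lambda> * max 0 (min 1 ((V - price_o y) / W0))"
    using feas W0 by (simp add: feasible_O_def l0_def W0_def type_prob_single)
  then show le: "l0 \<le> \<Lambda>"
    using \<Lambda> by (simp add: mult_left_le)
  have "l0 \<ge> 0"
    using l0 \<Lambda> by simp
  \<comment> \<open>A zero rate would force zero staff by the participation condition, leaving no
    spare capacity.\<close>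
  moreover have "l0 \<noteq> 0"
    using oper \<mu>o by (auto simp: ondemand_operation_def l0_def)
  ultimately show pos: "0 < l0"
    by simp
  have "l0 / \<Lambda> = max 0 (min 1 ((V - price_o y) / W0))"
    using l0 \<Lambda> by simp
  then have "l0 / \<Lambda> \<le> (V - price_o y) / W0"
    using pos \<Lambda> by (auto simp: max_def min_def split: if_splits)
  then have price_le: "price_o y \<le> V - l0 * W0 / \<Lambda>"
    using W0 by (simp add: pos_le_divide_eq)
  have net: "net_O l0 W0 = (V - l0 * W0 / \<Lambda>) * l0 - cost_o l0 W0"
    by (simp add: net_O_def algebra_simps power2_eq_square)
  have profit: "profit_O y = price_o y * l0 - cost_o l0 W0"
    using ondemand_operation_cost(1)[OF oper] by (simp add: profit_O_def l0_def W0_def)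
  have ge: "net_O l W \<le> profit_O y" if "0 < l" "l \<le> \<Lambda>" "0 < W" for l W
    using net_O_attained[OF that] best by metis
  \<comment> \<open>A lower price would be beaten by selling the same rate at the same lead time for
    \<open>V - l0 * W0 / \<Lambda>\<close>.\<close>
  have "V - l0 * W0 / \<Lambda> \<le> price_o y"
    using ge[OF pos le W0] net profit pos by simp
  then show price: "price_o y = V - l0 * W0 / \<Lambda>"
    using price_le by simp
  show "net_O l W \<le> net_O l0 W0" if "0 < l" "l \<le> \<Lambda>" "0 < W" for l W
    using ge[OF that] net profit price by simp
qed

lemma sigma_gt_1: "sigma V \<Lambda> > 1"
  using V \<Lambda> by (simp add: sigma_def)

text \<open>\<open>K_bar\<close> is the pool size at which \<open>sigma V \<Lambda> - 1\<close>, as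
  product of rate and lead time, meets the lead time condition of System O with all customers
  served.\<close>

lemma cube_ratio_sigma:
  "(sigma V \<Lambda> - 1) ^ 3 / (1 + (sigma V \<Lambda> - 1)) = 2 * \<Lambda>\<^sup>2 / (K_bar V \<Lambda> \<mu>o * \<mu>o\<^sup>2)"
  "K_bar V \<Lambda> \<mu>o > 0"
  using sigma_gt_1 \<Lambda> \<mu>o by (simp_all add: K_bar_def)

text \<open>The lead time is always interior, which gives the equation. The slope in the rate must
  be nonnegative, and zero below full coverage; up to the factor \<open>\<Lambda>\<close> it equals
  \<open>(sigma V \<Lambda>)\<^sup>2 - (L + 1)\<^sup>2\<close>.\<close>

lemma optimal_O_first_order:
  assumes opt: "optimal_O V \<Lambda> \<mu>o K y"
  defines "l0 \<equiv> rate_o y" and "W0 \<equiv> lead_o y"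
  defines "L \<equiv> l0 * W0"
  shows "L ^ 3 / (1 + L) = 2 * \<Lambda> * l0 / (K * \<mu>o\<^sup>2)"
    and "L \<le> sigma V \<Lambda> - 1" and "l0 < \<Lambda> \<Longrightarrow> L = sigma V \<Lambda> - 1"
proof -
  note net = optimal_O_net[OF opt, folded l0_def W0_def]
  let ?C = "K * \<mu>o\<^sup>2"
  have C: "?C > 0"
    using K \<mu>o by simp
  have "\<forall>\<^sub>F W in nhds W0. 0 < W"
    using net(3) by (rule eventually_nhds_in_open[OF open_greaterThan, simplified])
  then have "\<forall>\<^sub>F W in nhds W0. - (l0\<^sup>2 / \<Lambda>) * W - (l0 + 1 / W)\<^sup>2 / ?C
      \<le> - (l0\<^sup>2 / \<Lambda>) * W0 - (l0 + 1 / W0)\<^sup>2 / ?C"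
  proof eventually_elim
    case (elim W)
    then show ?case
      using net(5)[OF net(1,2) elim] by (simp add: net_O_def cost_o_def)
  qed
  from local_max_linear_square[OF net(3,1) C \<Lambda> this]
  have foc_W: "l0\<^sup>2 * (W0 ^ 3 / (L + 1)) = 2 * \<Lambda> / ?C"
    by (simp add: L_def)
  have L: "L > 0"
    using net by (simp add: L_def)
  have "L ^ 3 / (1 + L) = l0 * (l0\<^sup>2 * (W0 ^ 3 / (L + 1)))"
    by (simp add: L_def power_mult_distrib power2_eq_square power3_eq_cube add.commute)
  then show "L ^ 3 / (1 + L) = 2 * \<Lambda> * l0 / ?C"
    unfolding foc_W by simp
  define D where "D = V - 2 * l0 * W0 / \<Lambda> - 2 * (l0 + 1 / W0) / ?C"
  have deriv: "((\<lambda>l. net_O l W0) has_real_derivative D) (at l0)"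
    using quadratic_deriv[OF less_imp_neq[OF C, symmetric], of 0 V "W0 / \<Lambda>" "1 / W0" l0]
    by (simp add: net_O_def cost_o_def D_def mult_ac)
  \<comment> \<open>The lead time condition rewrites the marginal wage bill as
    \<open>L\<^sup>2 / \<Lambda>\<close>, so that \<open>D\<close> depends on the product
    \<open>L\<close> alone.\<close>
  have "W0 * (2 * (l0 + 1 / W0)) = 2 * (L + 1)"
    using net(3) by (simp add: L_def distrib_left)
  then have "W0 * (2 * (l0 + 1 / W0) / ?C) = 2 * \<Lambda> / ?C * (L + 1) / \<Lambda>"
    using \<Lambda> by simp
  also have "\<dots> = l0\<^sup>2 * W0 ^ 3 / \<Lambda>"
    unfolding foc_W[symmetric] using L by simp
  also have "\<dots> = W0 * (L\<^sup>2 / \<Lambda>)"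
    by (simp add: L_def power2_eq_square power3_eq_cube)
  finally have "2 * (l0 + 1 / W0) / ?C = L\<^sup>2 / \<Lambda>"
    using net(3) by (metis mult_left_cancel less_irrefl)
  then have "D = V - 2 * L / \<Lambda> - L\<^sup>2 / \<Lambda>"
    by (simp add: D_def L_def mult.commute)
  then have "\<Lambda> * D = V * \<Lambda> - 2 * L - L\<^sup>2"
    using \<Lambda> by (simp add: right_diff_distrib mult.commute)
  then have D: "\<Lambda> * D = (sigma V \<Lambda>)\<^sup>2 - (L + 1)\<^sup>2"
    using \<Lambda> V by (simp add: sigma_def power2_sum)
  \<comment> \<open>Lowering the rate is admissible even at \<open>l0 = \<Lambda>\<close>, where
    raising it is not.\<close>
  have "\<not> D < 0"
  proof
    assume "D < 0"
    from DERIV_neg_dec_left[OF deriv this]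
    obtain d where d: "d > 0" "\<And>h. 0 < h \<Longrightarrow> h < d \<Longrightarrow> net_O l0 W0 < net_O (l0 - h) W0"
      by blast
    obtain h where h: "0 < h" "h < d" "h < l0"
      using dense[of 0 "min d l0"] d(1) net(1) by auto
    have "net_O (l0 - h) W0 \<le> net_O l0 W0"
      using h net(2) by (intro net(5) net(3)) auto
    then show False
      using d(2)[OF h(1,2)] by simp
  qed
  then have "(L + 1)\<^sup>2 \<le> (sigma V \<Lambda>)\<^sup>2"
    using D \<Lambda> by (metis diff_ge_0_iff_ge less_eq_real_def linorder_not_less mult_nonneg_nonneg)
  then show "L \<le> sigma V \<Lambda> - 1"
    using sigma_gt_1 power2_le_imp_le[of "L + 1" "sigma V \<Lambda>"] by simp
  show "L = sigma V \<Lambda> - 1" if "l0 < \<Lambda>"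
  proof -
    have "\<forall>\<^sub>F l in nhds l0. l \<in> {0<..<\<Lambda>}"
      using net that by (intro eventually_nhds_in_open) auto
    then have "\<forall>\<^sub>F l in nhds l0. net_O l W0 \<le> net_O l0 W0"
      by eventually_elim (use net in auto)
    then have "D = 0"
      by (rule local_max_deriv_zero[OF deriv])
    then have "(L + 1)\<^sup>2 = (sigma V \<Lambda>)\<^sup>2"
      using D by simp
    then show ?thesis
      using sigma_gt_1 L power2_eq_iff_nonneg[of "L + 1" "sigma V \<Lambda>"] by simp
  qed
qed

text \<open>At full coverage a small pool makes the cube ratio at least that of
  \<open>sigma V \<Lambda> - 1\<close>, so the upper bound on the product is attained there as well.
  Comparing cube ratios then gives
  \<open>\<Lambda> * K = rate_o y * K_bar V \<Lambda> \<mu>o\<close>, hence the lead time.\<close>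

lemma optimal_O_small_pool:
  assumes opt: "optimal_O V \<Lambda> \<mu>o K y" and small: "K \<le> K_bar V \<Lambda> \<mu>o"
  shows "rate_o y * lead_o y = sigma V \<Lambda> - 1"
    and "lead_o y = K_bar V \<Lambda> \<mu>o * (sigma V \<Lambda> - 1) / (K * \<Lambda>)"
proof -
  note net = optimal_O_net[OF opt] and foc = optimal_O_first_order[OF opt]
  define L where "L = rate_o y * lead_o y"
  have L: "L > 0"
    using net by (simp add: L_def)
  show eq: "rate_o y * lead_o y = sigma V \<Lambda> - 1"
  proof (cases "rate_o y < \<Lambda>")
    case False
    then have "rate_o y = \<Lambda>"
      using net(2) by simp
    then have "L ^ 3 / (1 + L) = 2 * \<Lambda>\<^sup>2 / (K * \<mu>o\<^sup>2)"
      using foc(1) by (simp add: L_def power2_eq_square)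
    also have "\<dots> \<ge> 2 * \<Lambda>\<^sup>2 / (K_bar V \<Lambda> \<mu>o * \<mu>o\<^sup>2)"
      using small K \<mu>o \<Lambda> by (intro divide_left_mono mult_right_mono mult_pos_pos cube_ratio_sigma) auto
    finally have "sigma V \<Lambda> - 1 \<le> L"
      using cube_ratio_le_iff[of "sigma V \<Lambda> - 1" L] sigma_gt_1 L cube_ratio_sigma(1) by simp
    then show ?thesis
      using foc(2) by (simp add: L_def)
  qed (rule foc(3))
  have "2 * \<Lambda>\<^sup>2 / (K_bar V \<Lambda> \<mu>o * \<mu>o\<^sup>2) = 2 * \<Lambda> * rate_o y / (K * \<mu>o\<^sup>2)"
    using foc(1) cube_ratio_sigma(1) eq by metis
  then have "\<Lambda> * K = rate_o y * K_bar V \<Lambda> \<mu>o"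
    using cube_ratio_sigma(2) K \<mu>o \<Lambda> by (simp add: field_simps power2_eq_square)
  then have "lead_o y * (\<Lambda> * K) = K_bar V \<Lambda> \<mu>o * (sigma V \<Lambda> - 1)"
    unfolding eq[symmetric] by simp
  then show "lead_o y = K_bar V \<Lambda> \<mu>o * (sigma V \<Lambda> - 1) / (K * \<Lambda>)"
    using K \<Lambda> by (simp add: field_simps)
qed

text \<open>Incomplete coverage would again give
  \<open>\<Lambda> * K = rate_o y * K_bar V \<Lambda> \<mu>o\<close>, impossible for a large pool.
  At full coverage the product solves with equality the inequality defining \<open>L_bar_o\<close>,
  so by monotonicity it is the greatest element.\<close>

lemma optimal_O_large_pool:
  assumes opt: "optimal_O V \<Lambda> \<mu>o K y" and large: "K > K_bar V \<Lambda> \<mu>o"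
  shows "rate_o y = \<Lambda>" and "lead_o y = L_bar_o \<Lambda> \<mu>o K / \<Lambda>"
proof -
  note net = optimal_O_net[OF opt] and foc = optimal_O_first_order[OF opt]
  define L where "L = rate_o y * lead_o y"
  have L: "L > 0"
    using net by (simp add: L_def)
  show rate: "rate_o y = \<Lambda>"
  proof (rule ccontr)
    assume "rate_o y \<noteq> \<Lambda>"
    then have less: "rate_o y < \<Lambda>"
      using net(2) by simp
    then have "2 * \<Lambda>\<^sup>2 / (K_bar V \<Lambda> \<mu>o * \<mu>o\<^sup>2) = 2 * \<Lambda> * rate_o y / (K * \<mu>o\<^sup>2)"
      using foc(1,3) cube_ratio_sigma(1) by metis
    then have "\<Lambda> * K = rate_o y * K_bar V \<Lambda> \<mu>o"
      using cube_ratio_sigma(2) K \<mu>o \<Lambda> by (simp add: field_simps power2_eq_square)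
    also have "\<dots> < \<Lambda> * K"
      using less large net(1) cube_ratio_sigma(2) by (intro mult_strict_mono) auto
    finally show False
      by simp
  qed
  have L_eq: "L ^ 3 / (1 + L) = 2 * \<Lambda>\<^sup>2 / (K * \<mu>o\<^sup>2)"
    using foc(1) rate by (simp add: L_def power2_eq_square)
  have "L_bar_o \<Lambda> \<mu>o K = L"
    unfolding L_bar_o_def
    by (rule Greatest_equality) (use L L_eq cube_ratio_le_iff[of _ L] in auto)
  then show "lead_o y = L_bar_o \<Lambda> \<mu>o K / \<Lambda>"
    using rate \<Lambda> by (simp add: L_def)
qed

subsection \<open>Hybrid model\<close>

text \<open>Revenue at the highest prices supporting the two rates,
  \<open>V - (l1 + l2) * W1 / \<Lambda>\<close> and
  \<open>V - (l1 * W1 + l2 * W2) / \<Lambda>\<close>.\<close>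

definition revenue :: "real \<Rightarrow> real \<Rightarrow> real \<Rightarrow> real \<Rightarrow> real" where
  "revenue l1 W1 l2 W2 = V * (l1 + l2) - (W1 * l1 * (l1 + 2 * l2) + W2 * l2\<^sup>2) / \<Lambda>"

text \<open>The suffixes \<open>slow\<close> and \<open>fast\<close> refer to the on-demand service relative to the standard one;
  in \<open>revenue\<close>, service 1 is the faster one.\<close>

definition net_slow :: "real \<Rightarrow> real \<Rightarrow> real \<Rightarrow> real \<Rightarrow> real" where
  "net_slow ls Ws lo Wo = revenue ls Ws lo Wo - cost_s ls Ws - cost_o lo Wo"

definition net_fast :: "real \<Rightarrow> real \<Rightarrow> real \<Rightarrow> real \<Rightarrow> real" where
  "net_fast ls Ws lo Wo = revenue lo Wo ls Ws - cost_s ls Ws - cost_o lo Wo"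

text \<open>Competitors keep both services and the order of the lead times. All constraints except
  coverage are strict, so first-order conditions apply in each lead time.\<close>

definition slow_optimum :: "real \<Rightarrow> real \<Rightarrow> real \<Rightarrow> real \<Rightarrow> bool" where
  "slow_optimum ls Ws lo Wo \<longleftrightarrow> 0 < ls \<and> 0 < lo \<and> ls + lo \<le> \<Lambda> \<and> 0 < Ws \<and> Ws < Wo \<and>
     (\<forall>l W l' W'. 0 < l \<and> 0 < l' \<and> l + l' \<le> \<Lambda> \<and> 0 < W \<and> W < W' \<longrightarrow>
        net_slow l W l' W' \<le> net_slow ls Ws lo Wo)"

definition fast_optimum :: "real \<Rightarrow> real \<Rightarrow> real \<Rightarrow> real \<Rightarrow> bool" where
  "fast_optimum ls Ws lo Wo \<longleftrightarrow> 0 < ls \<and> 0 < lo \<and> ls + lo \<le> \<Lambda> \<and> 0 < Wo \<and> Wo < Ws \<and>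
     (\<forall>l W l' W'. 0 < l \<and> 0 < l' \<and> l + l' \<le> \<Lambda> \<and> 0 < W' \<and> W' < W \<longrightarrow>
        net_fast l W l' W' \<le> net_fast ls Ws lo Wo)"

text \<open>The rates fix the price difference, so a gap between \<open>p1\<close> and its upper
  bound is lost on every customer of both services.\<close>

lemma revenue_bound:
  assumes "0 < W1" "W1 < W2" "l1 > 0" "l2 > 0"
    and n1: "l1 / \<Lambda> = type_prob (\<lambda>\<theta>. utility V p1 W1 \<theta> \<ge> 0 \<and> utility V p1 W1 \<theta> \<ge> utility V p2 W2 \<theta>)"
    and n2: "l2 / \<Lambda> = type_prob (\<lambda>\<theta>. utility V p2 W2 \<theta> \<ge> 0 \<and> utility V p2 W2 \<theta> \<ge> utility V p1 W1 \<theta>)"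
  shows "l1 + l2 \<le> \<Lambda>" "p2 = p1 - l2 * (W2 - W1) / \<Lambda>"
    and "p1 * l1 + p2 * l2 \<le> revenue l1 W1 l2 W2"
    and "p1 * l1 + p2 * l2 = revenue l1 W1 l2 W2 \<Longrightarrow> p1 = V - (l1 + l2) * W1 / \<Lambda>"
proof -
  have pos: "l1 / \<Lambda> > 0" "l2 / \<Lambda> > 0"
    using assms(3,4) \<Lambda> by simp_all
  note shares = choice_shares[OF assms(1,2), of V p1 p2, folded n1 n2, OF pos]
  have total: "(l1 + l2) / \<Lambda> = min 1 ((V - p1) / W1)"
    using shares(2) by (simp add: add_divide_distrib)
  then have "(l1 + l2) / \<Lambda> \<le> 1" "(l1 + l2) / \<Lambda> \<le> (V - p1) / W1"
    by simp_all
  then show "l1 + l2 \<le> \<Lambda>"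
    using \<Lambda> by simp
  have slack: "p1 \<le> V - (l1 + l2) * W1 / \<Lambda>"
    using \<open>(l1 + l2) / \<Lambda> \<le> (V - p1) / W1\<close> assms by (simp add: pos_le_divide_eq)
  show p2: "p2 = p1 - l2 * (W2 - W1) / \<Lambda>"
    using shares(1) by simp
  have gap: "p1 * l1 + p2 * l2 = revenue l1 W1 l2 W2 - (V - (l1 + l2) * W1 / \<Lambda> - p1) * (l1 + l2)"
    unfolding revenue_def p2 using \<Lambda> by (simp add: field_simps power2_eq_square)
  have "(V - (l1 + l2) * W1 / \<Lambda> - p1) * (l1 + l2) \<ge> 0"
    using slack assms by (intro mult_nonneg_nonneg) auto
  then show "p1 * l1 + p2 * l2 \<le> revenue l1 W1 l2 W2"
    using gap by simp
  show "p1 = V - (l1 + l2) * W1 / \<Lambda>" if "p1 * l1 + p2 * l2 = revenue l1 W1 l2 W2"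
    using that gap assms by simp
qed

lemma revenue_attained:
  assumes "0 < W1" "W1 < W2" "l1 > 0" "l2 > 0" "l1 + l2 \<le> \<Lambda>"
  obtains p1 p2 where
    "type_prob (\<lambda>\<theta>. utility V p1 W1 \<theta> \<ge> 0 \<and> utility V p1 W1 \<theta> \<ge> utility V p2 W2 \<theta>) = l1 / \<Lambda>"
    "type_prob (\<lambda>\<theta>. utility V p2 W2 \<theta> \<ge> 0 \<and> utility V p2 W2 \<theta> \<ge> utility V p1 W1 \<theta>) = l2 / \<Lambda>"
    "p1 * l1 + p2 * l2 = revenue l1 W1 l2 W2"
proof -
  have n: "l1 / \<Lambda> > 0" "l2 / \<Lambda> > 0" "l1 / \<Lambda> + l2 / \<Lambda> \<le> 1"
    using assms \<Lambda> by (auto simp: add_divide_distrib[symmetric])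
  let ?p1 = "V - (l1 / \<Lambda> + l2 / \<Lambda>) * W1" and ?p2 = "V - (l1 / \<Lambda> * W1 + l2 / \<Lambda> * W2)"
  have "?p1 * l1 + ?p2 * l2 = revenue l1 W1 l2 W2"
    unfolding revenue_def using \<Lambda> by (simp add: field_simps power2_eq_square)
  with choice_shares_attained[OF assms(1,2) n] show thesis
    by (rule that)
qed

text \<open>Positive rates force both services to be offered, and distinct lead times exclude the
  tie case of \<open>hybrid_demand\<close>.\<close>

lemma feasible_hybrid_both:
  assumes feas: "feasible_hybrid V \<Lambda> \<mu>s \<mu>o K x"
    and pos: "rate_s x > 0" "rate_o x > 0" and leads: "lead_o x \<noteq> lead_s x"
  defines "Us \<equiv> utility V (price_s x) (lead_s x)" and "Uo \<equiv> utility V (price_o x) (lead_o x)"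
  shows "rate_s x / \<Lambda> = type_prob (\<lambda>\<theta>. Us \<theta> \<ge> 0 \<and> Us \<theta> \<ge> Uo \<theta>)"
    and "rate_o x / \<Lambda> = type_prob (\<lambda>\<theta>. Uo \<theta> \<ge> 0 \<and> Uo \<theta> \<ge> Us \<theta>)"
    and "lead_s x > 0" "lead_o x > 0"
    and "profit_hybrid ws x = price_s x * rate_s x + price_o x * rate_o x
      - cost_s (rate_s x) (lead_s x) - cost_o (rate_o x) (lead_o x)"
proof -
  have offers: "offers_s x" "offers_o x"
    using feas pos by (auto simp: feasible_hybrid_def split: if_splits)
  then have oper: "standard_operation \<mu>s x" "ondemand_operation \<mu>o K x"
    and demand: "hybrid_demand V \<Lambda> x"
    using feas by (auto simp: feasible_hybrid_def)
  show "rate_s x / \<Lambda> = type_prob (\<lambda>\<theta>. Us \<theta> \<ge> 0 \<and> Us \<theta> \<ge> Uo \<theta>)"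
    and "rate_o x / \<Lambda> = type_prob (\<lambda>\<theta>. Uo \<theta> \<ge> 0 \<and> Uo \<theta> \<ge> Us \<theta>)"
    using demand offers leads \<Lambda> by (auto simp: hybrid_demand_def Let_def Us_def Uo_def)
  show "lead_s x > 0" "lead_o x > 0"
    using standard_operation_cost(2) ondemand_operation_cost(2) oper by auto
  show "profit_hybrid ws x = price_s x * rate_s x + price_o x * rate_o x
      - cost_s (rate_s x) (lead_s x) - cost_o (rate_o x) (lead_o x)"
    using standard_operation_cost(1)[OF oper(1)] ondemand_operation_cost(1)[OF oper(2)]
    by (simp add: profit_hybrid_def)
qed

lemma feasible_hybrid_attained:
  assumes pos: "0 < ls" "0 < lo" "0 < Ws" "0 < Wo" and leads: "Ws \<noteq> Wo"
    and ns: "type_prob (\<lambda>\<theta>. utility V ps Ws \<theta> \<ge> 0 \<and> utility V ps Ws \<theta> \<ge> utility V po Wo \<theta>) = ls / \<Lambda>"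
    and no: "type_prob (\<lambda>\<theta>. utility V po Wo \<theta> \<ge> 0 \<and> utility V po Wo \<theta> \<ge> utility V ps Ws \<theta>) = lo / \<Lambda>"
  shows "\<exists>x. feasible_hybrid V \<Lambda> \<mu>s \<mu>o K x \<and>
    profit_hybrid ws x = ps * ls + po * lo - cost_s ls Ws - cost_o lo Wo"
proof -
  let ?x = "\<lparr>price_o = po, wage_o = cost_o lo Wo / lo, rate_o = lo,
    staff_o = (lo + 1 / Wo) / \<mu>o, lead_o = Wo, offers_s = True, offers_o = True,
    price_s = ps, rate_s = ls, staff_s = (ls + 1 / Ws) / \<mu>s, lead_s = Ws\<rparr>"
  have "ondemand_operation \<mu>o K ?x" "standard_operation \<mu>s ?x"
    by (rule ondemand_operation_attained standard_operation_attained; use pos in simp)+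
  moreover have "hybrid_demand V \<Lambda> ?x"
    using leads ns no \<Lambda> by (simp add: hybrid_demand_def)
  ultimately have "feasible_hybrid V \<Lambda> \<mu>s \<mu>o K ?x"
    by (simp add: feasible_hybrid_def)
  moreover have "profit_hybrid ws ?x = ps * ls + po * lo - cost_s ls Ws - cost_o lo Wo"
    using pos by (simp add: profit_hybrid_def cost_s_def)
  ultimately show ?thesis
    by blast
qed

text \<open>The profit is at most \<open>net_slow\<close> at its own rates and lead times, and every
  admissible value of \<open>net_slow\<close> is attained. The resulting equality gives both the
  optimality and the price.\<close>

lemma optimal_hybrid_slow:
  assumes opt: "optimal_hybrid V \<Lambda> \<mu>s \<mu>o ws K x"
    and pos: "rate_s x > 0" "rate_o x > 0" and slow: "lead_s x < lead_o x"
  shows "slow_optimum (rate_s x) (lead_s x) (rate_o x) (lead_o x)"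
    and "price_o x = V - (rate_s x * lead_s x + rate_o x * lead_o x) / \<Lambda>"
proof -
  have feas: "feasible_hybrid V \<Lambda> \<mu>s \<mu>o K x"
    and best: "\<And>z. feasible_hybrid V \<Lambda> \<mu>s \<mu>o K z \<Longrightarrow> profit_hybrid ws z \<le> profit_hybrid ws x"
    using opt by (auto simp: optimal_hybrid_def is_arg_max_linorder)
  have "lead_o x \<noteq> lead_s x"
    using slow by simp
  note both = feasible_hybrid_both[OF feas pos this]
  note rev = revenue_bound[OF both(3) slow pos both(1,2)]
  let ?net = "net_slow (rate_s x) (lead_s x) (rate_o x) (lead_o x)"
  have ge: "net_slow ls Ws lo Wo \<le> profit_hybrid ws x"
    if dom: "0 < ls" "0 < lo" "ls + lo \<le> \<Lambda>" "0 < Ws" "Ws < Wo" for ls Ws lo Wo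
  proof -
    obtain ps po where p:
      "type_prob (\<lambda>\<theta>. utility V ps Ws \<theta> \<ge> 0 \<and> utility V ps Ws \<theta> \<ge> utility V po Wo \<theta>) = ls / \<Lambda>"
      "type_prob (\<lambda>\<theta>. utility V po Wo \<theta> \<ge> 0 \<and> utility V po Wo \<theta> \<ge> utility V ps Ws \<theta>) = lo / \<Lambda>"
      "ps * ls + po * lo = revenue ls Ws lo Wo"
      by (rule revenue_attained[OF dom(4,5,1,2,3)])
    have "0 < Wo" "Ws \<noteq> Wo"
      using that by auto
    then obtain z where "feasible_hybrid V \<Lambda> \<mu>s \<mu>o K z"
      "profit_hybrid ws z = ps * ls + po * lo - cost_s ls Ws - cost_o lo Wo"
      using feasible_hybrid_attained[OF dom(1,2,4) _ _ p(1,2)] by blast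
    then show ?thesis
      using best[of z] p(3) by (simp add: net_slow_def)
  qed
  have "?net \<le> profit_hybrid ws x"
    by (intro ge pos rev both slow)
  moreover have "profit_hybrid ws x \<le> ?net"
    using both(5) rev(3) by (simp add: net_slow_def)
  ultimately have eq: "profit_hybrid ws x = ?net"
    by simp
  then show "slow_optimum (rate_s x) (lead_s x) (rate_o x) (lead_o x)"
    using ge pos rev(1) both(3) slow by (simp add: slow_optimum_def)
  have "price_s x = V - (rate_s x + rate_o x) * lead_s x / \<Lambda>"
    using rev(4) eq both(5) by (simp add: net_slow_def)
  then show "price_o x = V - (rate_s x * lead_s x + rate_o x * lead_o x) / \<Lambda>"
    using rev(2) \<Lambda> by (simp add: field_simps)
qed

lemma optimal_hybrid_fast:
  assumes opt: "optimal_hybrid V \<Lambda> \<mu>s \<mu>o ws K x"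
    and pos: "rate_s x > 0" "rate_o x > 0" and fast: "lead_o x < lead_s x"
  shows "fast_optimum (rate_s x) (lead_s x) (rate_o x) (lead_o x)"
    and "price_o x = V - (rate_o x + rate_s x) * lead_o x / \<Lambda>"
proof -
  have feas: "feasible_hybrid V \<Lambda> \<mu>s \<mu>o K x"
    and best: "\<And>z. feasible_hybrid V \<Lambda> \<mu>s \<mu>o K z \<Longrightarrow> profit_hybrid ws z \<le> profit_hybrid ws x"
    using opt by (auto simp: optimal_hybrid_def is_arg_max_linorder)
  have "lead_o x \<noteq> lead_s x"
    using fast by simp
  note both = feasible_hybrid_both[OF feas pos this]
  note rev = revenue_bound[OF both(4) fast pos(2,1) both(2,1)]
  let ?net = "net_fast (rate_s x) (lead_s x) (rate_o x) (lead_o x)"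
  have ge: "net_fast ls Ws lo Wo \<le> profit_hybrid ws x"
    if dom: "0 < ls" "0 < lo" "ls + lo \<le> \<Lambda>" "0 < Wo" "Wo < Ws" for ls Ws lo Wo
  proof -
    have "lo + ls \<le> \<Lambda>"
      using dom by simp
    then obtain po ps where p:
      "type_prob (\<lambda>\<theta>. utility V po Wo \<theta> \<ge> 0 \<and> utility V po Wo \<theta> \<ge> utility V ps Ws \<theta>) = lo / \<Lambda>"
      "type_prob (\<lambda>\<theta>. utility V ps Ws \<theta> \<ge> 0 \<and> utility V ps Ws \<theta> \<ge> utility V po Wo \<theta>) = ls / \<Lambda>"
      "po * lo + ps * ls = revenue lo Wo ls Ws"
      by (rule revenue_attained[OF dom(4,5,2,1)])
    have "0 < Ws" "Ws \<noteq> Wo"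
      using dom by auto
    then obtain z where "feasible_hybrid V \<Lambda> \<mu>s \<mu>o K z"
      "profit_hybrid ws z = ps * ls + po * lo - cost_s ls Ws - cost_o lo Wo"
      using feasible_hybrid_attained[OF dom(1,2) _ dom(4) _ p(2,1)] by blast
    then show ?thesis
      using best[of z] p(3) by (simp add: net_fast_def)
  qed
  have total: "rate_s x + rate_o x \<le> \<Lambda>"
    using rev(1) by simp
  have "?net \<le> profit_hybrid ws x"
    by (intro ge pos total both fast)
  moreover have "profit_hybrid ws x \<le> ?net"
    using both(5) rev(3) by (simp add: net_fast_def)
  ultimately have eq: "profit_hybrid ws x = ?net"
    by simp
  then show "fast_optimum (rate_s x) (lead_s x) (rate_o x) (lead_o x)"
    using ge pos total both(4) fast by (simp add: fast_optimum_def)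
  show "price_o x = V - (rate_o x + rate_s x) * lead_o x / \<Lambda>"
    using rev(4) eq both(5) by (simp add: net_fast_def)
qed

section \<open>First-order conditions and coverage with a slower on-demand service\<close>

lemma slow_optimum_lead_o:
  assumes "slow_optimum ls Ws lo Wo"
  shows "lo\<^sup>2 * (Wo ^ 3 / (lo * Wo + 1)) = 2 * \<Lambda> / (K * \<mu>o\<^sup>2)"
proof (rule local_max_linear_square)
  have opt: "0 < ls" "0 < lo" "ls + lo \<le> \<Lambda>" "0 < Ws" "Ws < Wo"
    "\<And>l W l' W'. 0 < l \<Longrightarrow> 0 < l' \<Longrightarrow> l + l' \<le> \<Lambda> \<Longrightarrow> 0 < W \<Longrightarrow> W < W' \<Longrightarrow>
      net_slow l W l' W' \<le> net_slow ls Ws lo Wo"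
    using assms by (auto simp: slow_optimum_def)
  show "Wo > 0" "lo > 0" "K * \<mu>o\<^sup>2 > 0" "\<Lambda> > 0"
    using opt K \<mu>o \<Lambda> by auto
  have "\<forall>\<^sub>F W in nhds Wo. W \<in> {Ws<..}"
    using opt by (intro eventually_nhds_in_open) auto
  then show "\<forall>\<^sub>F W in nhds Wo. - (lo\<^sup>2 / \<Lambda>) * W - (lo + 1 / W)\<^sup>2 / (K * \<mu>o\<^sup>2)
      \<le> - (lo\<^sup>2 / \<Lambda>) * Wo - (lo + 1 / Wo)\<^sup>2 / (K * \<mu>o\<^sup>2)"
  proof eventually_elim
    case (elim W)
    \<comment> \<open>\<open>net_slow\<close> depends on \<open>Wo\<close> exactly as
      \<open>net_O\<close> does at rate \<open>lo\<close>, so the condition has the form of System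
      O.\<close>
    then have "net_slow ls Ws lo W \<le> net_slow ls Ws lo Wo"
      using opt by auto
    then show ?case
      by (simp add: net_slow_def revenue_def cost_o_def add_divide_distrib mult.commute)
  qed
qed

text \<open>The faster lead time lowers both prices: its weight is \<open>ls * (ls + lo)\<close>
  through the standard price plus \<open>lo * ls\<close> through the on-demand price.\<close>

lemma slow_optimum_lead_s:
  assumes "slow_optimum ls Ws lo Wo"
  shows "ls * (ls + 2 * lo) / \<Lambda> * Ws\<^sup>2 = ws / \<mu>s"
proof (rule local_max_linear_inverse)
  have opt: "0 < ls" "0 < lo" "ls + lo \<le> \<Lambda>" "0 < Ws" "Ws < Wo"
    "\<And>l W l' W'. 0 < l \<Longrightarrow> 0 < l' \<Longrightarrow> l + l' \<le> \<Lambda> \<Longrightarrow> 0 < W \<Longrightarrow> W < W' \<Longrightarrow>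
      net_slow l W l' W' \<le> net_slow ls Ws lo Wo"
    using assms by (auto simp: slow_optimum_def)
  show "Ws > 0"
    by fact
  have "\<forall>\<^sub>F W in nhds Ws. W \<in> {0<..<Wo}"
    using opt by (intro eventually_nhds_in_open) auto
  then show "\<forall>\<^sub>F W in nhds Ws. - (ls * (ls + 2 * lo) / \<Lambda>) * W - ws / \<mu>s / W
      \<le> - (ls * (ls + 2 * lo) / \<Lambda>) * Ws - ws / \<mu>s / Ws"
  proof eventually_elim
    case (elim W)
    then have "net_slow ls W lo Wo \<le> net_slow ls Ws lo Wo"
      using opt by auto
    moreover have "net_slow ls W' lo Wo = - (ls * (ls + 2 * lo) / \<Lambda>) * W' - ws / \<mu>s / W'
      + (V * (ls + lo) - Wo * lo\<^sup>2 / \<Lambda> - ws * ls / \<mu>s - cost_o lo Wo)" for W'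
      by (simp add: net_slow_def revenue_def cost_s_def add_divide_distrib distrib_left algebra_simps)
    ultimately show ?case
      by simp
  qed
qed

text \<open>If \<open>ls * Ws\<close> is held fixed, the profit is affine in \<open>ls\<close>. At an optimum with incomplete
  coverage it is therefore constant, so neighbouring values of \<open>ls\<close> are optimal as well, and the
  first-order conditions for the standard lead time at two of them are incompatible.\<close>

lemma slow_optimum_full_coverage:
  assumes o: "slow_optimum ls Ws lo Wo"
  shows "ls + lo = \<Lambda>"
proof (rule ccontr)
  have opt: "0 < ls" "0 < lo" "ls + lo \<le> \<Lambda>" "0 < Ws" "Ws < Wo"
    "\<And>l W l' W'. 0 < l \<Longrightarrow> 0 < l' \<Longrightarrow> l + l' \<le> \<Lambda> \<Longrightarrow> 0 < W \<Longrightarrow> W < W' \<Longrightarrow>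
      net_slow l W l' W' \<le> net_slow ls Ws lo Wo"
    using o by (auto simp: slow_optimum_def)
  assume "ls + lo \<noteq> \<Lambda>"
  then have less: "ls + lo < \<Lambda>"
    using opt by simp
  \<comment> \<open>On the curve \<open>W = t / l\<close> both the waiting term
    \<open>W * l * (l + 2 * lo)\<close> and the capacity \<open>l + 1 / W\<close> are affine in
    \<open>l\<close>.\<close>
  define t where "t = ls * Ws"
  have t: "t > 0"
    using opt by (simp add: t_def)
  define \<alpha> where "\<alpha> = V - t / \<Lambda> - ws / \<mu>s - ws / (\<mu>s * t)"
  define \<beta> where "\<beta> = V * lo - (2 * t * lo + Wo * lo\<^sup>2) / \<Lambda> - cost_o lo Wo"
  have affine: "net_slow l (t / l) lo Wo = \<alpha> * l + \<beta>" if "l > 0" for l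
  proof -
    have "t / l * l = t" "1 / (t / l) = l / t"
      using that by simp_all
    then show ?thesis
      unfolding net_slow_def revenue_def cost_s_def \<alpha>_def \<beta>_def
      by (simp add: add_divide_distrib diff_divide_distrib algebra_simps power2_eq_square)
  qed
  have Ws: "Ws = t / ls"
    using opt by (simp add: t_def)
  have le: "\<alpha> * l \<le> \<alpha> * ls" if "0 < l" "l + lo \<le> \<Lambda>" "t / l < Wo" for l
    using opt(6)[of l lo "t / l" Wo] affine[OF that(1)] affine[OF opt(1)] that opt t
    by (simp add: Ws[symmetric])
  obtain r where r: "ls < r" "r + lo < \<Lambda>"
    using dense[of ls "\<Lambda> - lo"] less by (auto simp: less_diff_eq)
  have "t / r < t / ls"
    using r t opt by (intro divide_strict_left_mono) auto
  then have r': "t / r < Wo"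
    using opt Ws by simp
  \<comment> \<open>A smaller standard rate lengthens its lead time along the curve; staying above
    \<open>t / Wo\<close> keeps that service the faster one.\<close>
  have "t / Wo < ls" "t / Wo > 0"
    using opt t by (auto simp: t_def field_simps)
  then obtain q where q: "0 < q" "q < ls" "t / Wo < q"
    using dense[of "t / Wo" ls] by (meson order.strict_trans)
  then have q': "t / q < Wo"
    using opt by (simp add: field_simps)
  have "\<alpha> * r \<le> \<alpha> * ls"
    by (rule le) (use r r' opt in auto)
  then have "\<alpha> \<le> 0"
    using r by (simp add: mult_le_cancel_left)
  moreover have "\<alpha> * q \<le> \<alpha> * ls"
    by (rule le) (use q q' opt in auto)
  then have "\<alpha> \<ge> 0"
    using q by (simp add: mult_le_cancel_left)
  ultimately have "\<alpha> = 0"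
    by simp
  then have "net_slow r (t / r) lo Wo = net_slow ls Ws lo Wo"
    using affine[of r] affine[of ls] r opt Ws by simp
  then have "slow_optimum r (t / r) lo Wo"
    using opt r r' t by (simp add: slow_optimum_def)
  \<comment> \<open>For fixed \<open>t\<close> the left side of this condition is proportional to
    \<open>(ls + 2 * lo) / ls\<close>, which is injective in \<open>ls\<close>.\<close>
  from slow_optimum_lead_s[OF this] slow_optimum_lead_s[OF o]
  have "r * (r + 2 * lo) / \<Lambda> * (t / r)\<^sup>2 = ls * (ls + 2 * lo) / \<Lambda> * (t / ls)\<^sup>2"
    using Ws by simp
  then have "(r + 2 * lo) / r = (ls + 2 * lo) / ls"
    using t r opt \<Lambda> by (simp add: field_simps power2_eq_square)
  then show False
    using r opt by (simp add: field_simps)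
qed

section \<open>First-order conditions and coverage with a faster on-demand service\<close>

lemma fast_optimum_lead_o:
  assumes "fast_optimum ls Ws lo Wo"
  shows "lo * (lo + 2 * ls) * (Wo ^ 3 / (lo * Wo + 1)) = 2 * \<Lambda> / (K * \<mu>o\<^sup>2)"
proof (rule local_max_linear_square)
  have opt: "0 < ls" "0 < lo" "ls + lo \<le> \<Lambda>" "0 < Wo" "Wo < Ws"
    "\<And>l W l' W'. 0 < l \<Longrightarrow> 0 < l' \<Longrightarrow> l + l' \<le> \<Lambda> \<Longrightarrow> 0 < W' \<Longrightarrow> W' < W \<Longrightarrow>
      net_fast l W l' W' \<le> net_fast ls Ws lo Wo"
    using assms by (auto simp: fast_optimum_def)
  show "Wo > 0" "lo > 0" "K * \<mu>o\<^sup>2 > 0" "\<Lambda> > 0"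
    using opt K \<mu>o \<Lambda> by auto
  have "\<forall>\<^sub>F W in nhds Wo. W \<in> {0<..<Ws}"
    using opt by (intro eventually_nhds_in_open) auto
  then show "\<forall>\<^sub>F W in nhds Wo. - (lo * (lo + 2 * ls) / \<Lambda>) * W - (lo + 1 / W)\<^sup>2 / (K * \<mu>o\<^sup>2)
      \<le> - (lo * (lo + 2 * ls) / \<Lambda>) * Wo - (lo + 1 / Wo)\<^sup>2 / (K * \<mu>o\<^sup>2)"
  proof eventually_elim
    case (elim W)
    then have "net_fast ls Ws lo W \<le> net_fast ls Ws lo Wo"
      using opt by auto
    then show ?case
      by (simp add: net_fast_def revenue_def cost_o_def add_divide_distrib mult_ac)
  qed
qed

text \<open>Unserved customers leave room to move the on-demand rate both ways, so the derivative in
  it vanishes.\<close>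

lemma fast_optimum_rate_o:
  assumes "fast_optimum ls Ws lo Wo" "ls + lo < \<Lambda>"
  shows "V - 2 * Wo * (lo + ls) / \<Lambda> - 2 * (lo + 1 / Wo) / (K * \<mu>o\<^sup>2) = 0"
proof (rule local_max_deriv_zero)
  have opt: "0 < ls" "0 < lo" "ls + lo \<le> \<Lambda>" "0 < Wo" "Wo < Ws"
    "\<And>l W l' W'. 0 < l \<Longrightarrow> 0 < l' \<Longrightarrow> l + l' \<le> \<Lambda> \<Longrightarrow> 0 < W' \<Longrightarrow> W' < W \<Longrightarrow>
      net_fast l W l' W' \<le> net_fast ls Ws lo Wo"
    using assms by (auto simp: fast_optimum_def)
  have C: "K * \<mu>o\<^sup>2 \<noteq> 0"
    using K \<mu>o by simp
  have "net_fast ls Ws l Wo = V * ls - Ws * ls\<^sup>2 / \<Lambda> - cost_s ls Ws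
      + (V - 2 * Wo * ls / \<Lambda>) * l - Wo / \<Lambda> * l\<^sup>2 - (l + 1 / Wo)\<^sup>2 / (K * \<mu>o\<^sup>2)" for l
    by (simp add: net_fast_def revenue_def cost_o_def add_divide_distrib algebra_simps power2_eq_square)
  moreover have "V - 2 * Wo * ls / \<Lambda> - 2 * (Wo / \<Lambda>) * lo = V - 2 * Wo * (lo + ls) / \<Lambda>"
    by (simp add: add_divide_distrib algebra_simps)
  ultimately show "((\<lambda>l. net_fast ls Ws l Wo) has_real_derivative
      V - 2 * Wo * (lo + ls) / \<Lambda> - 2 * (lo + 1 / Wo) / (K * \<mu>o\<^sup>2)) (at lo)"
    using quadratic_deriv[OF C, of "V * ls - Ws * ls\<^sup>2 / \<Lambda> - cost_s ls Ws" "V - 2 * Wo * ls / \<Lambda>"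
        "Wo / \<Lambda>" "1 / Wo" lo] by (simp only:)
  have "\<forall>\<^sub>F l in nhds lo. l \<in> {0<..<\<Lambda> - ls}"
    using opt assms(2) by (intro eventually_nhds_in_open) auto
  then show "\<forall>\<^sub>F l in nhds lo. net_fast ls Ws l Wo \<le> net_fast ls Ws lo Wo"
    by eventually_elim (use opt in auto)
qed

text \<open>Here the incompatible conditions are those for the on-demand rate, which contain \<open>ls\<close>
  through the term \<open>2 * Wo * (lo + ls) / \<Lambda>\<close> only.\<close>

lemma fast_optimum_full_coverage:
  assumes o: "fast_optimum ls Ws lo Wo"
  shows "ls + lo = \<Lambda>"
proof (rule ccontr)
  have opt: "0 < ls" "0 < lo" "ls + lo \<le> \<Lambda>" "0 < Wo" "Wo < Ws"
    "\<And>l W l' W'. 0 < l \<Longrightarrow> 0 < l' \<Longrightarrow> l + l' \<le> \<Lambda> \<Longrightarrow> 0 < W' \<Longrightarrow> W' < W \<Longrightarrow>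
      net_fast l W l' W' \<le> net_fast ls Ws lo Wo"
    using o by (auto simp: fast_optimum_def)
  assume "ls + lo \<noteq> \<Lambda>"
  then have less: "ls + lo < \<Lambda>"
    using opt by simp
  define t where "t = ls * Ws"
  have t: "t > 0"
    using opt by (simp add: t_def)
  define \<alpha> where "\<alpha> = V - (2 * Wo * lo + t) / \<Lambda> - ws / \<mu>s - ws / (\<mu>s * t)"
  define \<beta> where "\<beta> = V * lo - Wo * lo\<^sup>2 / \<Lambda> - cost_o lo Wo"
  have affine: "net_fast l (t / l) lo Wo = \<alpha> * l + \<beta>" if "l > 0" for l
  proof -
    have "t / l * l\<^sup>2 = t * l" "1 / (t / l) = l / t"
      using that by (simp_all add: power2_eq_square)
    then show ?thesis
      unfolding net_fast_def revenue_def cost_s_def \<alpha>_def \<beta>_def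
      by (simp add: add_divide_distrib diff_divide_distrib algebra_simps power2_eq_square)
  qed
  have Ws: "Ws = t / ls"
    using opt by (simp add: t_def)
  have le: "\<alpha> * l \<le> \<alpha> * ls" if "0 < l" "l + lo \<le> \<Lambda>" "Wo < t / l" for l
    using opt(6)[of l lo Wo "t / l"] affine[OF that(1)] affine[OF opt(1)] that opt
    by (simp add: Ws[symmetric])
  \<comment> \<open>Now raising the standard rate is the delicate direction: the standard lead time
    must stay above \<open>Wo\<close>. Halving the rate merely doubles that lead time.\<close>
  have "ls < t / Wo"
    using opt t by (simp add: t_def field_simps)
  then obtain r where r: "ls < r" "r + lo < \<Lambda>" "r < t / Wo"
    using dense[of ls "min (\<Lambda> - lo) (t / Wo)"] less by (auto simp: less_diff_eq)
  then have r': "Wo < t / r"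
    using opt by (simp add: field_simps)
  have q: "Wo < t / (ls / 2)"
    using opt by (simp add: t_def)
  have "\<alpha> * r \<le> \<alpha> * ls"
    by (rule le) (use r r' opt in auto)
  then have "\<alpha> \<le> 0"
    using r by (simp add: mult_le_cancel_left)
  moreover have "\<alpha> * (ls / 2) \<le> \<alpha> * ls"
    by (rule le) (use q opt in auto)
  then have "\<alpha> \<ge> 0"
    using opt(1) by (simp add: zero_le_mult_iff)
  ultimately have "\<alpha> = 0"
    by simp
  then have "net_fast r (t / r) lo Wo = net_fast ls Ws lo Wo"
    using affine[of r] affine[of ls] r opt Ws by simp
  then have "fast_optimum r (t / r) lo Wo"
    using opt r r' by (simp add: fast_optimum_def)
  \<comment> \<open>The condition for the standard lead time would give no contradiction here: it
    involves only the product \<open>ls * Ws\<close>, constant along the curve.\<close>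
  from fast_optimum_rate_o[OF this r(2)] fast_optimum_rate_o[OF o less]
  have "2 * Wo * (lo + r) / \<Lambda> = 2 * Wo * (lo + ls) / \<Lambda>"
    by linarith
  then show False
    using r opt \<Lambda> by simp
qed

subsection \<open>Comparison of the two systems\<close>

text \<open>Given the first-order conditions, \<open>R\<close> equals \<open>ls * Ws\<close> and the
  equation of the region identifies \<open>G - 1\<close> with \<open>lo * Wo\<close>. The first
  inequality then orders the prices and the second the lead times.\<close>

lemma T1_comparison:
  assumes hyb: "optimal_hybrid V \<Lambda> \<mu>s \<mu>o ws K x"
    and pos: "rate_s x > 0" "rate_o x > 0" and slow: "lead_s x < lead_o x"
    and T1: "T1_condition V \<Lambda> \<mu>s \<mu>o ws K (rate_o x)"
    and y: "optimal_O V \<Lambda> \<mu>o K y"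
  shows "price_o x \<le> price_o y" "lead_o x \<ge> lead_o y"
proof -
  define ls Ws lo Wo where "ls = rate_s x" "Ws = lead_s x" "lo = rate_o x" "Wo = lead_o x"
  note defs = this
  note netO = optimal_O_net[OF y]
  have o: "slow_optimum ls Ws lo Wo" and price: "price_o x = V - (ls * Ws + lo * Wo) / \<Lambda>"
    using optimal_hybrid_slow[OF hyb pos slow] by (simp_all add: defs)
  have w: "0 < ls" "0 < lo" "0 < Ws" "0 < Wo"
    using o by (auto simp: slow_optimum_def)
  have total: "ls + lo = \<Lambda>"
    by (rule slow_optimum_full_coverage[OF o])
  define R where "R = sqrt (ws * \<Lambda> * (\<Lambda> - lo) / (\<mu>s * (\<Lambda> + lo)))"
  define G where "G = G_fun \<Lambda> \<mu>s ws lo"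
  define D where "D = (\<lambda>c. 2 * \<Lambda> / (K * \<mu>o\<^sup>2) - lo\<^sup>2 * c ^ 3 / (lo * c + 1))"
  have cond: "(G - 1) ^ 3 / G = 2 * \<Lambda> * lo / (K * \<mu>o\<^sup>2)"
    "K \<le> K_bar V \<Lambda> \<mu>o \<Longrightarrow> G + R - sigma V \<Lambda> \<ge> 0 \<and>
       D (K_bar V \<Lambda> \<mu>o * (sigma V \<Lambda> - 1) / (K * \<Lambda>)) \<ge> 0"
    "K > K_bar V \<Lambda> \<mu>o \<Longrightarrow> G - 1 + R - L_bar_o \<Lambda> \<mu>o K \<ge> 0 \<and> D (L_bar_o \<Lambda> \<mu>o K / \<Lambda>) \<ge> 0"
    using T1 unfolding T1_condition_def Let_def G_def R_def D_def defs by blast+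
  have C: "K * \<mu>o\<^sup>2 > 0"
    using K \<mu>o by simp
  have sum: "\<Lambda> + lo > 0" "\<Lambda> - lo = ls" "ls + 2 * lo = \<Lambda> + lo"
    using w \<Lambda> total by auto
  have "(ls * Ws)\<^sup>2 = ls * \<Lambda> / (\<Lambda> + lo) * (ls * (\<Lambda> + lo) / \<Lambda> * Ws\<^sup>2)"
    using \<Lambda> sum(1) by (simp add: power_mult_distrib power2_eq_square)
  also have "\<dots> = ls * \<Lambda> / (\<Lambda> + lo) * (ws / \<mu>s)"
    using slow_optimum_lead_s[OF o] unfolding sum by simp
  also have "\<dots> = ws * \<Lambda> * (\<Lambda> - lo) / (\<mu>s * (\<Lambda> + lo))"
    unfolding sum by (simp add: mult.commute mult.left_commute)
  finally have "(ls * Ws)\<^sup>2 = ws * \<Lambda> * (\<Lambda> - lo) / (\<mu>s * (\<Lambda> + lo))" .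
  then have R: "ls * Ws = R"
    unfolding R_def using w by (intro real_sqrt_unique[symmetric]) auto
  have lead: "lo\<^sup>2 * (Wo ^ 3 / (lo * Wo + 1)) = 2 * \<Lambda> / (K * \<mu>o\<^sup>2)"
    by (rule slow_optimum_lead_o[OF o])
  have "(lo * Wo) ^ 3 / (1 + lo * Wo) = lo * (lo\<^sup>2 * (Wo ^ 3 / (lo * Wo + 1)))"
    by (simp add: power_mult_distrib power2_eq_square power3_eq_cube add.commute)
  then have load: "(lo * Wo) ^ 3 / (1 + lo * Wo) = 2 * \<Lambda> * lo / (K * \<mu>o\<^sup>2)"
    unfolding lead by simp
  \<comment> \<open>Injectivity of the cube ratio needs \<open>G > 1\<close>: the formula gives
    \<open>G \<ge> 1\<close>, and the positive right side of the region's equation excludes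
    \<open>G = 1\<close>.\<close>
  have "2 * sqrt (ws * \<Lambda> / \<mu>s) * lo / sqrt (\<Lambda>\<^sup>2 - lo\<^sup>2) \<ge> 0"
  proof -
    have "lo\<^sup>2 \<le> \<Lambda>\<^sup>2"
      using w total by (intro power_mono) auto
    then show ?thesis
      using w ws \<Lambda> \<mu>s by simp
  qed
  moreover have "ws * \<Lambda> / \<mu>s \<ge> 0"
    using ws \<Lambda> \<mu>s by simp
  ultimately have "G \<ge> 1"
    unfolding G_def G_fun_def Let_def by simp
  moreover have "G \<noteq> 1"
    using cond(1) w C \<Lambda> by auto
  ultimately have "G - 1 > 0"
    by simp
  moreover have "(G - 1) ^ 3 / (1 + (G - 1)) = (lo * Wo) ^ 3 / (1 + lo * Wo)"
    using cond(1) load by simp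
  ultimately have G: "G - 1 = lo * Wo"
    using cube_ratio_inj[of "G - 1" "lo * Wo"] w by simp
  \<comment> \<open>In both cases the argument of \<open>D\<close> is the lead time of System
    O.\<close>
  have "rate_o y * lead_o y \<le> G - 1 + R \<and> D (lead_o y) \<ge> 0"
  proof (cases "K \<le> K_bar V \<Lambda> \<mu>o")
    case True
    then show ?thesis
      using cond(2) optimal_O_small_pool[OF y] by simp
  next
    case False
    then show ?thesis
      using cond(3) optimal_O_large_pool[OF y] \<Lambda> by simp
  qed
  then have load_le: "rate_o y * lead_o y \<le> ls * Ws + lo * Wo"
    and ratio: "lo\<^sup>2 * (lead_o y ^ 3 / (lo * lead_o y + 1)) \<le> lo\<^sup>2 * (Wo ^ 3 / (lo * Wo + 1))"
    using G R lead by (simp_all add: D_def)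
  from ratio have "lead_o y ^ 3 / (lo * lead_o y + 1) \<le> Wo ^ 3 / (lo * Wo + 1)"
    by (rule mult_left_le_imp_le) (use w in simp)
  then show "lead_o x \<ge> lead_o y"
    using scaled_cube_ratio_le_iff[of lo "lead_o y" Wo] w netO(3) by (simp add: defs)
  show "price_o x \<le> price_o y"
    using load_le \<Lambda> by (simp add: price netO(4) divide_right_mono)
qed

text \<open>Full coverage makes the hybrid price \<open>V - Wo\<close>, while System O charges
  \<open>V - c\<close> with \<open>c\<close> at most its lead time. So \<open>Wo \<le> c\<close>
  settles both claims.\<close>

lemma T2_comparison:
  assumes hyb: "optimal_hybrid V \<Lambda> \<mu>s \<mu>o ws K x"
    and pos: "rate_s x > 0" "rate_o x > 0" and fast: "lead_o x < lead_s x"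
    and T2: "T2_condition V \<Lambda> \<mu>s \<mu>o ws K (rate_o x)"
    and y: "optimal_O V \<Lambda> \<mu>o K y"
  shows "price_o x \<ge> price_o y" "lead_o x \<le> lead_o y"
proof -
  define ls Ws lo Wo where "ls = rate_s x" "Ws = lead_s x" "lo = rate_o x" "Wo = lead_o x"
  note defs = this
  note netO = optimal_O_net[OF y]
  define c where
    "c = (if K \<le> K_bar V \<Lambda> \<mu>o then (sigma V \<Lambda> - 1) / \<Lambda> else L_bar_o \<Lambda> \<mu>o K / \<Lambda>)"
  have o: "fast_optimum ls Ws lo Wo" and price: "price_o x = V - (lo + ls) * Wo / \<Lambda>"
    using optimal_hybrid_fast[OF hyb pos fast] by (simp_all add: defs)
  have w: "0 < ls" "0 < lo" "0 < Wo" "0 < Ws"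
    using o by (auto simp: fast_optimum_def)
  have total: "ls + lo = \<Lambda>"
    by (rule fast_optimum_full_coverage[OF o])
  have C: "K * \<mu>o\<^sup>2 > 0" "2 * \<Lambda> - lo > 0"
    using K \<mu>o w total by auto
  have c: "c * \<Lambda> = rate_o y * lead_o y" "c \<le> lead_o y" "c > 0"
  proof -
    show eq: "c * \<Lambda> = rate_o y * lead_o y"
      using optimal_O_small_pool(1)[OF y] optimal_O_large_pool[OF y] \<Lambda>
      by (cases "K \<le> K_bar V \<Lambda> \<mu>o") (simp_all add: c_def)
    also have "\<dots> \<le> lead_o y * \<Lambda>"
      using netO by simp
    finally show "c \<le> lead_o y"
      using \<Lambda> by simp
    have "c * \<Lambda> > 0"
      using eq netO by simp
    then show "c > 0"
      using \<Lambda> by (simp add: zero_less_mult_iff)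
  qed
  \<comment> \<open>Full coverage turns the weight \<open>lo + 2 * ls\<close> of the lead time
    condition into the factor in the definition of the region.\<close>
  have sum: "2 * \<Lambda> - lo = lo + 2 * ls"
    using total by simp
  have "lo * (Wo ^ 3 / (lo * Wo + 1)) * (2 * \<Lambda> - lo) = lo * (lo + 2 * ls) * (Wo ^ 3 / (lo * Wo + 1))"
    unfolding sum by (simp only: mult_ac)
  also have "\<dots> = 2 * \<Lambda> / (K * \<mu>o\<^sup>2)"
    by (rule fast_optimum_lead_o[OF o])
  finally have lead: "lo * (Wo ^ 3 / (lo * Wo + 1)) = 2 * \<Lambda> / (K * \<mu>o\<^sup>2 * (2 * \<Lambda> - lo))"
    unfolding divide_divide_eq_left[symmetric] using C(2) by (subst nonzero_eq_divide_eq) auto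
  have "2 * \<Lambda> / (K * \<mu>o\<^sup>2 * (2 * \<Lambda> - lo)) - lo * c ^ 3 / (lo * c + 1) \<le> 0"
    using T2 unfolding T2_condition_def Let_def c_def defs by blast
  then have "lo * (Wo ^ 3 / (lo * Wo + 1)) \<le> lo * (c ^ 3 / (lo * c + 1))"
    unfolding lead by simp
  then have "Wo ^ 3 / (lo * Wo + 1) \<le> c ^ 3 / (lo * c + 1)"
    by (rule mult_left_le_imp_le) (use w in simp)
  then have le: "Wo \<le> c"
    using scaled_cube_ratio_le_iff[of lo Wo c] w c by simp
  then show "lead_o x \<le> lead_o y"
    using c(2) by (simp add: defs)
  have "rate_o y * lead_o y / \<Lambda> = c"
    using c(1) \<Lambda> by (simp add: field_simps)
  moreover have "(lo + ls) * Wo / \<Lambda> = Wo"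
    using total \<Lambda> by (simp add: add.commute)
  ultimately show "price_o x \<ge> price_o y"
    using le by (simp add: price netO(4))
qed

end

theorem theorem5:
  fixes V \<Lambda> \<mu>s \<mu>o ws K :: real and x :: hybrid and y :: ondemand
  assumes "V > 0" "\<Lambda> > 0" "\<mu>s > 0" "\<mu>o > 0" "ws > 0" "K > 0"
    and "V \<ge> C_bar_s \<Lambda> \<mu>s ws"
    and "optimal_hybrid V \<Lambda> \<mu>s \<mu>o ws K x" "rate_s x > 0" "rate_o x > 0"
    and "optimal_O V \<Lambda> \<mu>o K y"
  shows "(lead_o x > lead_s x \<and> T1_condition V \<Lambda> \<mu>s \<mu>o ws K (rate_o x) \<longrightarrow>
            price_o x \<le> price_o y \<and> lead_o x \<ge> lead_o y) \<and>
         (lead_o x < lead_s x \<and> T2_condition V \<Lambda> \<mu>s \<mu>o ws K (rate_o x) \<longrightarrow>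
            price_o x \<ge> price_o y \<and> lead_o x \<le> lead_o y)"
proof -
  interpret market V \<Lambda> \<mu>s \<mu>o ws K
    by unfold_locales fact+
  show ?thesis
    using T1_comparison[OF assms(8-10)] T2_comparison[OF assms(8-10)] assms(11) by blast
qed

end
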